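(* For every integer $r\geq 1$, there exists a connected graph $G$ with an edge $e$ such that deleting $e$ preserves connectivity and increases the gonality of $G$ by exactly $r$: $\operatorname{gon}(G-e)=\operatorname{gon}(G)+r$.
   Context: Graphs are finite, connected, undirected, loopless multigraphs. $\operatorname{gon}(G)$ denotes the divisorial gonality of $G$, i.e. the minimum degree of a divisor of positive rank in the chip-firing (Baker–Norine) divisor theory on $G$. *)

theory Defs
  imports Main "HOL-Library.Multiset"
begin

text \<open>
  An edge is a two-element vertex set; parallel edges are recorded by the multiplicities in
  the edge multiset, so that two vertices u and v are joined by count (mg_edges G) {u, v} edges.
\<close>

record 'v mgraph =
  mg_verts :: "'v set"
  mg_edges :: "'v set multiset"

definition multigraph :: "'v mgraph \<Rightarrow> bool" where
  "multigraph G \<longleftrightarrow>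
     finite (mg_verts G) \<and> mg_verts G \<noteq> {} \<and>
     (\<forall>e \<in># mg_edges G. e \<subseteq> mg_verts G \<and> card e = 2)"

definition mg_adj :: "'v mgraph \<Rightarrow> 'v \<Rightarrow> 'v \<Rightarrow> bool" where
  "mg_adj G u v \<longleftrightarrow> {u, v} \<in># mg_edges G"

definition mg_connected :: "'v mgraph \<Rightarrow> bool" where
  "mg_connected G \<longleftrightarrow> (\<forall>u \<in> mg_verts G. \<forall>v \<in> mg_verts G. (mg_adj G)\<^sup>*\<^sup>* u v)"

text \<open>Exactly one copy of a multiple edge is removed.\<close>

definition mg_delete_edge :: "'v mgraph \<Rightarrow> 'v set \<Rightarrow> 'v mgraph" where
  "mg_delete_edge G e = G\<lparr>mg_edges := mg_edges G - {#e#}\<rparr>"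

text \<open>
  A divisor is an integer-valued function on the vertices. It is represented by a total function
  whose values outside the vertex set are irrelevant: every notion below only depends on the
  restriction to the vertex set.
\<close>

type_synonym 'v divisor = "'v \<Rightarrow> int"

definition div_degree :: "'v mgraph \<Rightarrow> 'v divisor \<Rightarrow> int" where
  "div_degree G D = (\<Sum>v \<in> mg_verts G. D v)"

definition div_effective :: "'v mgraph \<Rightarrow> 'v divisor \<Rightarrow> bool" where
  "div_effective G D \<longleftrightarrow> (\<forall>v \<in> mg_verts G. 0 \<le> D v)"

definition mg_laplacian :: "'v mgraph \<Rightarrow> ('v \<Rightarrow> int) \<Rightarrow> 'v divisor" where
  "mg_laplacian G f v = (\<Sum>u \<in> mg_verts G. int (count (mg_edges G) {u, v}) * (f v - f u))"

definition div_equiv :: "'v mgraph \<Rightarrow> 'v divisor \<Rightarrow> 'v divisor \<Rightarrow> bool" where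
  "div_equiv G D D' \<longleftrightarrow> (\<exists>f. \<forall>v \<in> mg_verts G. D' v = D v - mg_laplacian G f v)"

definition equiv_effective :: "'v mgraph \<Rightarrow> 'v divisor \<Rightarrow> bool" where
  "equiv_effective G D \<longleftrightarrow> (\<exists>D'. div_equiv G D D' \<and> div_effective G D')"

text \<open>
  The Baker--Norine rank. The set of admissible k contains 0 in the second case and is bounded
  by the degree of D, as equivalent divisors have the same degree; so the maximum exists.
\<close>

definition div_rank :: "'v mgraph \<Rightarrow> 'v divisor \<Rightarrow> int" where
  "div_rank G D =
     (if \<not> equiv_effective G D then - 1
      else int (GREATEST k :: nat. \<forall>E. div_effective G E \<and> div_degree G E = int k
                   \<longrightarrow> equiv_effective G (\<lambda>v. D v - E v)))"

text \<open>
  A divisor of positive rank is equivalent to an effective one, so its degree is a natural number;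
  placing one chip on every vertex gives a divisor of positive rank, so the minimum exists.
\<close>

definition gonality :: "'v mgraph \<Rightarrow> nat" where
  "gonality G = (LEAST d :: nat. \<exists>D. div_degree G D = int d \<and> div_rank G D > 0)"

end

theory Submission
  imports Defs "HOL-Library.Countable"
begin

text \<open>
  Two vertices joined by more edges than the degree of an effective divisor are fired equally often
  on the way to any other effective divisor. Take two sets of r + 1 vertices, each tied together by
  such heavy edges, and join one vertex of the first set to one of the second by a path with r + 2
  edges; join the r other vertices of each set to an additional vertex, the centre of a star. Let e
  be an edge between the two centres. As the heavy edges carry no chips, the path has a constant
  number of chips, which is at least 1, and so have the two stars together, where r chips are needed
  to occupy all leaves of one star. These r + 1 chips suffice: they traverse the graph level by
  level, r of them crossing e one at a time while the last one walks along the path. Without e each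
  star needs r chips of its own, and the gonality becomes 2 r + 1.
\<close>

section \<open>Firing scripts, rank and gonality\<close>

definition fire :: "'v mgraph \<Rightarrow> ('v \<Rightarrow> int) \<Rightarrow> 'v divisor \<Rightarrow> 'v divisor" where
  "fire G f D v = D v - mg_laplacian G f v"

lemma mg_laplacian_add:
  "mg_laplacian G (\<lambda>x. f x + g x) v = mg_laplacian G f v + mg_laplacian G g v"
  by (simp add: mg_laplacian_def sum.distrib[symmetric] algebra_simps)

lemma mg_laplacian_const [simp]: "mg_laplacian G (\<lambda>_. c) v = 0"
  by (simp add: mg_laplacian_def)

lemma fire_const [simp]: "fire G (\<lambda>_. c) D = D"
  by (simp add: fire_def fun_eq_iff)

lemma fire_fire: "fire G g (fire G f D) = fire G (\<lambda>x. f x + g x) D"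
  by (simp add: fire_def mg_laplacian_add fun_eq_iff)

lemma fire_diff: "fire G f (\<lambda>v. D v - E v) = (\<lambda>v. fire G f D v - E v)"
  by (simp add: fire_def fun_eq_iff)

lemma sum_edge_differences_inside:
  "(\<Sum>v\<in>A. \<Sum>u\<in>A. int (count (mg_edges G) {u, v}) * (f v - f u)) = 0" (is "?S = 0")
proof -
  have "?S = (\<Sum>v\<in>A. \<Sum>u\<in>A. int (count (mg_edges G) {u, v}) * (f u - f v))"
    by (subst sum.swap) (simp add: insert_commute)
  also have "\<dots> = - ?S"
    by (simp add: sum_negf[symmetric] algebra_simps)
  finally show ?thesis by simp
qed

lemma sum_mg_laplacian_eq_boundary:
  assumes "finite (mg_verts G)" "A \<subseteq> mg_verts G"
  shows "(\<Sum>v\<in>A. mg_laplacian G f v) =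
    (\<Sum>v\<in>A. \<Sum>u\<in>mg_verts G - A. int (count (mg_edges G) {u, v}) * (f v - f u))"
proof -
  let ?d = "\<lambda>u v. int (count (mg_edges G) {u, v}) * (f v - f u)"
  have "(\<Sum>v\<in>A. mg_laplacian G f v) =
      (\<Sum>v\<in>A. (\<Sum>u\<in>mg_verts G - A. ?d u v) + (\<Sum>u\<in>A. ?d u v))"
    unfolding mg_laplacian_def by (intro sum.cong refl sum.subset_diff assms)
  then show ?thesis
    by (simp add: sum.distrib sum_edge_differences_inside)
qed

lemma div_degree_fire [simp]: "div_degree G (fire G f D) = div_degree G D"
  by (simp add: div_degree_def fire_def sum_subtractf mg_laplacian_def sum_edge_differences_inside)

lemma equiv_effective_iff_fire:
  "equiv_effective G D \<longleftrightarrow> (\<exists>f. div_effective G (fire G f D))"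
  unfolding equiv_effective_def div_equiv_def div_effective_def fire_def by fastforce

lemma equiv_effective_fire [simp]: "equiv_effective G (fire G f D) \<longleftrightarrow> equiv_effective G D"
proof
  assume "equiv_effective G (fire G f D)"
  then show "equiv_effective G D"
    by (auto simp: equiv_effective_iff_fire fire_fire)
next
  assume "equiv_effective G D"
  then obtain g where "div_effective G (fire G g D)"
    by (auto simp: equiv_effective_iff_fire)
  then have "div_effective G (fire G (\<lambda>x. g x - f x) (fire G f D))"
    by (simp add: fire_fire)
  then show "equiv_effective G (fire G f D)"
    unfolding equiv_effective_iff_fire by blast
qed

lemma div_rank_fire [simp]: "div_rank G (fire G f D) = div_rank G D"
  by (simp add: div_rank_def fire_diff[symmetric])

lemma equiv_effective_mono:
  assumes "equiv_effective G D" "\<And>v. v \<in> mg_verts G \<Longrightarrow> D v \<le> D' v"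
  shows "equiv_effective G D'"
proof -
  obtain f where f: "\<And>v. v \<in> mg_verts G \<Longrightarrow> 0 \<le> fire G f D v"
    using assms(1) unfolding equiv_effective_iff_fire div_effective_def by blast
  have "0 \<le> fire G f D' v" if "v \<in> mg_verts G" for v
    using f[OF that] assms(2)[OF that] by (simp add: fire_def)
  then show ?thesis unfolding equiv_effective_iff_fire div_effective_def by blast
qed

lemma div_degree_nonneg: "div_effective G D \<Longrightarrow> 0 \<le> div_degree G D"
  by (simp add: div_effective_def div_degree_def sum_nonneg)

lemma equiv_effective_degree_nonneg: "equiv_effective G D \<Longrightarrow> 0 \<le> div_degree G D"
  unfolding equiv_effective_iff_fire by (metis div_degree_nonneg div_degree_fire)

definition chips_at :: "'v \<Rightarrow> int \<Rightarrow> 'v divisor" where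
  "chips_at v c w = (if w = v then c else 0)"

lemma div_effective_chips_at: "0 \<le> c \<Longrightarrow> div_effective G (chips_at v c)"
  by (simp add: div_effective_def chips_at_def)

lemma div_degree_chips_at:
  "multigraph G \<Longrightarrow> v \<in> mg_verts G \<Longrightarrow> div_degree G (chips_at v c) = c"
  by (simp add: div_degree_def chips_at_def multigraph_def)

lemma effective_degree_zero:
  assumes "multigraph G" "div_effective G E" "div_degree G E = 0" "v \<in> mg_verts G"
  shows "E v = 0"
  using assms by (simp add: multigraph_def div_effective_def div_degree_def sum_nonneg_eq_0_iff)

lemma effective_degree_one:
  assumes G: "multigraph G" and E: "div_effective G E" "div_degree G E = 1"
  obtains v where "v \<in> mg_verts G" "\<And>w. w \<in> mg_verts G \<Longrightarrow> E w = chips_at v 1 w"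
proof -
  obtain v where v: "v \<in> mg_verts G" "E v \<noteq> 0"
    using E(2) unfolding div_degree_def by (metis sum.neutral zero_neq_one)
  have "div_effective G (\<lambda>w. E w - chips_at v 1 w)"
    using E(1) v by (auto simp: div_effective_def chips_at_def order_le_less)
  moreover have "div_degree G (\<lambda>w. E w - chips_at v 1 w) = 0"
    using div_degree_chips_at[OF G v(1), of 1] E(2) by (simp add: div_degree_def sum_subtractf)
  ultimately have "E w = chips_at v 1 w" if "w \<in> mg_verts G" for w
    using effective_degree_zero[OF G _ _ that] by fastforce
  with v(1) show ?thesis by (rule that)
qed

definition has_rank_ge :: "'v mgraph \<Rightarrow> 'v divisor \<Rightarrow> nat \<Rightarrow> bool" where
  "has_rank_ge G D k \<longleftrightarrow>
     (\<forall>E. div_effective G E \<and> div_degree G E = int k \<longrightarrow> equiv_effective G (\<lambda>v. D v - E v))"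

lemma div_rank_eq_Greatest:
  "div_rank G D = (if equiv_effective G D then int (GREATEST k. has_rank_ge G D k) else - 1)"
  by (simp add: div_rank_def has_rank_ge_def)

lemma has_rank_ge_le_degree:
  assumes G: "multigraph G" and "has_rank_ge G D k"
  shows "int k \<le> div_degree G D"
proof -
  obtain w where w: "w \<in> mg_verts G" using G by (auto simp: multigraph_def)
  have "equiv_effective G (\<lambda>v. D v - chips_at w (int k) v)"
    using assms w by (simp add: has_rank_ge_def div_effective_chips_at div_degree_chips_at)
  from equiv_effective_degree_nonneg[OF this] div_degree_chips_at[OF G w, of "int k"]
  show ?thesis by (simp add: div_degree_def sum_subtractf)
qed

lemma has_rank_ge_antimono:
  assumes G: "multigraph G" and "has_rank_ge G D k" "j \<le> k"
  shows "has_rank_ge G D j"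
  unfolding has_rank_ge_def
proof (intro allI impI, elim conjE)
  fix E assume E: "div_effective G E" "div_degree G E = int j"
  obtain w where w: "w \<in> mg_verts G" using G by (auto simp: multigraph_def)
  let ?E' = "\<lambda>v. E v + chips_at w (int (k - j)) v"
  have "div_effective G ?E'"
    using E(1) by (simp add: div_effective_def chips_at_def)
  moreover have "div_degree G ?E' = int k"
    using div_degree_chips_at[OF G w, of "int (k - j)"] E(2) assms(3)
    by (simp add: div_degree_def sum.distrib)
  ultimately have "equiv_effective G (\<lambda>v. D v - ?E' v)"
    using assms(2) unfolding has_rank_ge_def by blast
  then show "equiv_effective G (\<lambda>v. D v - E v)"
    by (rule equiv_effective_mono) (simp add: chips_at_def)
qed

lemma has_rank_ge_zero_iff:
  assumes G: "multigraph G"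
  shows "has_rank_ge G D 0 \<longleftrightarrow> equiv_effective G D"
proof
  assume "has_rank_ge G D 0"
  moreover have "div_effective G (\<lambda>_. 0)" "div_degree G (\<lambda>_. 0) = int 0"
    by (simp_all add: div_effective_def div_degree_def)
  ultimately have "equiv_effective G (\<lambda>v. D v - 0)"
    unfolding has_rank_ge_def by blast
  then show "equiv_effective G D" by simp
next
  assume "equiv_effective G D"
  then show "has_rank_ge G D 0"
    unfolding has_rank_ge_def
    by (auto elim!: equiv_effective_mono simp: effective_degree_zero[OF G])
qed

lemma div_rank_ge_iff:
  assumes G: "multigraph G"
  shows "int k \<le> div_rank G D \<longleftrightarrow> has_rank_ge G D k"
proof (cases "equiv_effective G D")
  case False
  then have "\<not> has_rank_ge G D k"
    using has_rank_ge_antimono[OF G, of D k 0] has_rank_ge_zero_iff[OF G] by blast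
  with False show ?thesis by (simp add: div_rank_eq_Greatest)
next
  case True
  let ?m = "GREATEST j. has_rank_ge G D j"
  have bounded: "j \<le> nat (div_degree G D)" if "has_rank_ge G D j" for j
    using has_rank_ge_le_degree[OF G that] by simp
  have greatest: "has_rank_ge G D ?m"
    using GreatestI_nat[of "has_rank_ge G D" 0, OF _ bounded] True
    by (simp add: has_rank_ge_zero_iff[OF G])
  have "k \<le> ?m \<longleftrightarrow> has_rank_ge G D k"
  proof
    assume "k \<le> ?m"
    then show "has_rank_ge G D k" by (rule has_rank_ge_antimono[OF G greatest])
  next
    assume "has_rank_ge G D k"
    then show "k \<le> ?m" by (rule Greatest_le_nat) (rule bounded)
  qed
  with True show ?thesis by (simp add: div_rank_eq_Greatest)
qed

lemma has_rank_ge_one_iff: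
  assumes G: "multigraph G"
  shows "has_rank_ge G D 1 \<longleftrightarrow>
    (\<forall>v\<in>mg_verts G. equiv_effective G (\<lambda>w. D w - chips_at v 1 w))" (is "_ \<longleftrightarrow> ?R")
proof
  assume "has_rank_ge G D 1"
  then show ?R
    using G by (simp add: has_rank_ge_def div_effective_chips_at div_degree_chips_at)
next
  assume each_vertex: ?R
  show "has_rank_ge G D 1"
    unfolding has_rank_ge_def
  proof (intro allI impI, elim conjE)
    fix E assume E: "div_effective G E" "div_degree G E = int 1"
    then obtain v where v: "v \<in> mg_verts G" "\<And>w. w \<in> mg_verts G \<Longrightarrow> E w = chips_at v 1 w"
      using effective_degree_one[OF G] by (metis of_nat_1)
    have "equiv_effective G (\<lambda>w. D w - chips_at v 1 w)"
      using each_vertex v(1) by blast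
    then show "equiv_effective G (\<lambda>v. D v - E v)"
      by (rule equiv_effective_mono) (simp add: v(2))
  qed
qed

lemma div_rank_pos_iff:
  assumes G: "multigraph G"
  shows "0 < div_rank G D \<longleftrightarrow>
    (\<forall>v\<in>mg_verts G. \<exists>f. div_effective G (fire G f D) \<and> 1 \<le> fire G f D v)"
proof -
  have "div_effective G (fire G f (\<lambda>w. D w - chips_at v 1 w)) \<longleftrightarrow>
      div_effective G (fire G f D) \<and> 1 \<le> fire G f D v" if "v \<in> mg_verts G" for f v
    using that by (force simp: div_effective_def fire_diff chips_at_def)
  then have "has_rank_ge G D 1 \<longleftrightarrow>
      (\<forall>v\<in>mg_verts G. \<exists>f. div_effective G (fire G f D) \<and> 1 \<le> fire G f D v)"
    unfolding has_rank_ge_one_iff[OF G] equiv_effective_iff_fire by blast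
  then show ?thesis
    using div_rank_ge_iff[OF G, of 1 D] by (simp add: int_one_le_iff_zero_less)
qed

lemma gonality_eqI:
  assumes G: "multigraph G"
    and D: "div_degree G D = int d" "0 < div_rank G D"
    and lower: "\<And>D. div_effective G D \<Longrightarrow> 0 < div_rank G D \<Longrightarrow> int d \<le> div_degree G D"
  shows "gonality G = d"
  unfolding gonality_def
proof (rule Least_equality)
  show "\<exists>D. div_degree G D = int d \<and> 0 < div_rank G D" using D by blast
next
  fix d' assume "\<exists>D. div_degree G D = int d' \<and> 0 < div_rank G D"
  then obtain D' where D': "div_degree G D' = int d'" "0 < div_rank G D'" by blast
  from D'(2) have "equiv_effective G D'" by (auto simp: div_rank_def split: if_splits)
  then obtain f where "div_effective G (fire G f D')"
    by (auto simp: equiv_effective_iff_fire)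
  from lower[OF this] D' show "d \<le> d'" by simp
qed

text \<open>
  The superlevel set of f just above f b loses, across its boundary, at least f a - f b chips per
  copy of the edge from a to b.
\<close>

lemma edge_flow_le_degree:
  assumes G: "multigraph G" and ab: "a \<in> mg_verts G" "b \<in> mg_verts G"
    and D: "div_effective G D" and fire: "div_effective G (fire G f D)"
  shows "int (count (mg_edges G) {a, b}) * (f a - f b) \<le> div_degree G D"
proof (cases "f a \<le> f b")
  case True
  then have "int (count (mg_edges G) {a, b}) * (f a - f b) \<le> 0"
    by (simp add: mult_nonneg_nonpos)
  then show ?thesis using div_degree_nonneg[OF D] by linarith
next
  case False
  let ?V = "mg_verts G" and ?d = "\<lambda>u v. int (count (mg_edges G) {u, v}) * (f v - f u)"
  define A where "A = {v\<in>?V. f b < f v}"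
  have V: "finite ?V" using G by (simp add: multigraph_def)
  have A: "A \<subseteq> ?V" "finite A" "a \<in> A" "b \<in> ?V - A"
    using V ab False by (auto simp: A_def)
  have "?d b a \<le> (\<Sum>u\<in>?V - A. ?d u a)"
    using A V by (intro member_le_sum) (auto simp: A_def)
  also have "\<dots> \<le> (\<Sum>v\<in>A. \<Sum>u\<in>?V - A. ?d u v)"
    using A by (intro member_le_sum[where f = "\<lambda>v. \<Sum>u\<in>?V - A. ?d u v"] sum_nonneg)
      (auto simp: A_def)
  also have "\<dots> = (\<Sum>v\<in>A. mg_laplacian G f v)"
    by (rule sum_mg_laplacian_eq_boundary[OF V A(1), symmetric])
  also have "\<dots> \<le> (\<Sum>v\<in>A. D v)"
    using fire A by (intro sum_mono) (auto simp: div_effective_def fire_def)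
  also have "\<dots> \<le> div_degree G D"
    using D A V unfolding div_degree_def div_effective_def by (intro sum_mono2) auto
  finally show ?thesis by (simp add: insert_commute)
qed

lemma script_eq_across_heavy_edge:
  assumes G: "multigraph G" and ab: "a \<in> mg_verts G" "b \<in> mg_verts G"
    and D: "div_effective G D" "div_effective G (fire G f D)"
    and heavy: "div_degree G D < int (count (mg_edges G) {a, b})"
  shows "f a = f b"
proof -
  have "f x \<le> f y" if xy: "x \<in> mg_verts G" "y \<in> mg_verts G" "{x, y} = {a, b}" for x y
  proof (rule ccontr)
    assume "\<not> f x \<le> f y"
    then have "int (count (mg_edges G) {x, y}) * 1 \<le> int (count (mg_edges G) {x, y}) * (f x - f y)"
      by (intro mult_left_mono) simp_all
    then show False
      using edge_flow_le_degree[OF G xy(1,2) D] heavy xy(3) by simp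
  qed
  from this[of a b] this[of b a] ab show ?thesis by (simp add: insert_commute)
qed

section \<open>Renaming vertices\<close>

definition map_mgraph :: "('v \<Rightarrow> 'w) \<Rightarrow> 'v mgraph \<Rightarrow> 'w mgraph" where
  "map_mgraph h G = \<lparr>mg_verts = h ` mg_verts G, mg_edges = image_mset ((`) h) (mg_edges G)\<rparr>"

lemma mg_verts_map_mgraph [simp]: "mg_verts (map_mgraph h G) = h ` mg_verts G"
  by (simp add: map_mgraph_def)

lemma mg_edges_map_mgraph [simp]: "mg_edges (map_mgraph h G) = image_mset ((`) h) (mg_edges G)"
  by (simp add: map_mgraph_def)

lemma multigraph_map_mgraph:
  assumes h: "inj h" and G: "multigraph G"
  shows "multigraph (map_mgraph h G)"
proof -
  have "card (h ` e) = card e" for e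
    using h by (intro card_image) (rule inj_on_subset, auto)
  with G show ?thesis by (auto simp: multigraph_def)
qed

lemma mg_connected_map_mgraph:
  assumes "mg_connected G"
  shows "mg_connected (map_mgraph h G)"
proof -
  have adj: "mg_adj (map_mgraph h G) (h u) (h v)" if "mg_adj G u v" for u v
    using imageI[OF that[unfolded mg_adj_def], of "(`) h"] by (simp add: mg_adj_def)
  have "(mg_adj (map_mgraph h G))\<^sup>*\<^sup>* (h u) (h v)" if "(mg_adj G)\<^sup>*\<^sup>* u v" for u v
    using that by induction (auto intro: adj rtranclp.rtrancl_into_rtrancl)
  with assms show ?thesis by (auto simp: mg_connected_def)
qed

lemma mg_delete_edge_map_mgraph:
  assumes "e \<in># mg_edges G"
  shows "mg_delete_edge (map_mgraph h G) (h ` e) = map_mgraph h (mg_delete_edge G e)"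
  using assms by (simp add: mg_delete_edge_def map_mgraph_def image_mset_Diff)

lemma count_image_mset_inj: "inj f \<Longrightarrow> count (image_mset f M) (f x) = count M x"
  by (induction M) (auto dest: injD)

lemma mg_laplacian_map_mgraph:
  assumes h: "inj h"
  shows "mg_laplacian (map_mgraph h G) f (h v) = mg_laplacian G (f \<circ> h) v"
proof -
  have "inj ((`) h)" using h by (simp add: inj_image_eq_iff inj_def)
  then have "count (mg_edges (map_mgraph h G)) {h u, h v} = count (mg_edges G) {u, v}" for u
    using count_image_mset_inj[of "(`) h" "mg_edges G" "{u, v}"] by simp
  then show ?thesis
    using h by (simp add: mg_laplacian_def sum.reindex inj_on_subset)
qed

lemma div_effective_map_mgraph: "div_effective (map_mgraph h G) D \<longleftrightarrow> div_effective G (D \<circ> h)"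
  by (simp add: div_effective_def)

lemma div_degree_map_mgraph: "inj h \<Longrightarrow> div_degree (map_mgraph h G) D = div_degree G (D \<circ> h)"
  by (simp add: div_degree_def sum.reindex inj_on_subset)

lemma ex_comp_inj_iff:
  assumes "inj h"
  shows "(\<exists>f. P (f \<circ> h)) \<longleftrightarrow> (\<exists>g. P g)"
proof
  assume "\<exists>g. P g"
  then obtain g where "P g" ..
  then have "P ((g \<circ> inv h) \<circ> h)" using assms by (simp add: comp_assoc)
  then show "\<exists>f. P (f \<circ> h)" by blast
qed blast

lemma all_comp_inj_iff: "inj h \<Longrightarrow> (\<forall>f. P (f \<circ> h)) \<longleftrightarrow> (\<forall>g. P g)"
  using ex_comp_inj_iff[of h "\<lambda>g. \<not> P g"] by blast

lemma equiv_effective_map_mgraph: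
  assumes "inj h"
  shows "equiv_effective (map_mgraph h G) D \<longleftrightarrow> equiv_effective G (D \<circ> h)"
proof -
  have "fire (map_mgraph h G) f D \<circ> h = fire G (f \<circ> h) (D \<circ> h)" for f
    using assms by (simp add: fire_def mg_laplacian_map_mgraph fun_eq_iff)
  then show ?thesis
    using ex_comp_inj_iff[OF assms, of "\<lambda>g. div_effective G (fire G g (D \<circ> h))"]
    by (simp add: equiv_effective_iff_fire div_effective_map_mgraph)
qed

lemma div_rank_map_mgraph:
  assumes "inj h"
  shows "div_rank (map_mgraph h G) D = div_rank G (D \<circ> h)"
proof -
  have "has_rank_ge (map_mgraph h G) D = has_rank_ge G (D \<circ> h)"
    using all_comp_inj_iff[OF assms, of "\<lambda>E. div_effective G E \<and> div_degree G E = int k \<longrightarrow>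
        equiv_effective G (\<lambda>v. D (h v) - E v)" for k]
    by (simp add: fun_eq_iff has_rank_ge_def div_effective_map_mgraph
        div_degree_map_mgraph[OF assms] equiv_effective_map_mgraph[OF assms] comp_def)
  then show ?thesis
    by (simp add: div_rank_eq_Greatest equiv_effective_map_mgraph[OF assms])
qed

lemma gonality_map_mgraph:
  assumes "inj h"
  shows "gonality (map_mgraph h G) = gonality G"
  using ex_comp_inj_iff[OF assms, of "\<lambda>D. div_degree G D = int d \<and> 0 < div_rank G D" for d]
  by (simp add: gonality_def div_degree_map_mgraph[OF assms] div_rank_map_mgraph[OF assms])

section \<open>Multigraphs from oriented edges\<close>

definition mgraph_of :: "'v set \<Rightarrow> ('v \<times> 'v) multiset \<Rightarrow> 'v mgraph" where
  "mgraph_of V E = \<lparr>mg_verts = V, mg_edges = image_mset (\<lambda>(a, b). {a, b}) E\<rparr>"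

lemma mg_verts_mgraph_of [simp]: "mg_verts (mgraph_of V E) = V"
  by (simp add: mgraph_of_def)

lemma multigraph_mgraph_of:
  assumes "finite V" "V \<noteq> {}" "\<And>a b. (a, b) \<in># E \<Longrightarrow> a \<in> V \<and> b \<in> V \<and> a \<noteq> b"
  shows "multigraph (mgraph_of V E)"
  using assms by (fastforce simp: multigraph_def mgraph_of_def)

lemma mg_adj_mgraph_of: "(a, b) \<in># E \<Longrightarrow> mg_adj (mgraph_of V E) a b"
  by (force simp: mg_adj_def mgraph_of_def)

lemma count_mgraph_of_ge: "count E (a, b) \<le> count (mg_edges (mgraph_of V E)) {a, b}"
  by (induction E) (auto simp: mgraph_of_def)

lemma mg_laplacian_mgraph_of_add_edge:
  assumes "finite V" "a \<in> V" "b \<in> V" "a \<noteq> b"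
  shows "mg_laplacian (mgraph_of V (add_mset (a, b) E)) f v =
    mg_laplacian (mgraph_of V E) f v + (of_bool (a = v) - of_bool (b = v)) * (f a - f b)"
proof -
  have "mg_laplacian (mgraph_of V (add_mset (a, b) E)) f v =
      mg_laplacian (mgraph_of V E) f v + (\<Sum>u\<in>V. of_bool ({a, b} = {u, v}) * (f v - f u))"
    unfolding mg_laplacian_def mg_verts_mgraph_of sum.distrib[symmetric]
    by (intro sum.cong refl) (simp add: mgraph_of_def algebra_simps)
  also have "(\<Sum>u\<in>V. of_bool ({a, b} = {u, v}) * (f v - f u)) =
      (\<Sum>u\<in>V. (if u = a then of_bool (b = v) * (f b - f a) else 0) +
        (if u = b then of_bool (a = v) * (f a - f b) else 0))"
    using assms by (intro sum.cong refl) (auto simp: doubleton_eq_iff)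
  also have "\<dots> = (of_bool (a = v) - of_bool (b = v)) * (f a - f b)"
    using assms by (simp add: sum.distrib algebra_simps)
  finally show ?thesis .
qed

lemma sum_mg_laplacian_mgraph_of:
  assumes V: "finite V" and A: "A \<subseteq> V"
    and "\<And>a b. (a, b) \<in># E \<Longrightarrow> a \<in> V \<and> b \<in> V \<and> a \<noteq> b"
  shows "(\<Sum>v\<in>A. mg_laplacian (mgraph_of V E) f v) =
    (\<Sum>(a, b)\<in>#E. (of_bool (a \<in> A) - of_bool (b \<in> A)) * (f a - f b))"
  using assms(3)
proof (induction E)
  case empty
  then show ?case by (simp add: mg_laplacian_def mgraph_of_def)
next
  case (add x E)
  obtain a b where x: "x = (a, b)" by force
  have ab: "a \<in> V" "b \<in> V" "a \<noteq> b" using add.prems[of a b] x by auto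
  have "finite A" using A V by (rule finite_subset)
  then have "(\<Sum>v\<in>A. of_bool (c = v)) = (of_bool (c \<in> A) :: int)" for c
    by (simp add: of_bool_def)
  then have "(\<Sum>v\<in>A. (of_bool (a = v) - of_bool (b = v)) * (f a - f b)) =
      (of_bool (a \<in> A) - of_bool (b \<in> A)) * (f a - f b)"
    by (simp add: sum_distrib_right[symmetric] sum_subtractf)
  moreover have "(\<Sum>v\<in>A. mg_laplacian (mgraph_of V E) f v) =
      (\<Sum>(a, b)\<in>#E. (of_bool (a \<in> A) - of_bool (b \<in> A)) * (f a - f b))"
    using add.prems by (intro add.IH) auto
  ultimately show ?case
    by (simp add: x mg_laplacian_mgraph_of_add_edge[OF V ab] sum.distrib)
qed

lemma mg_connected_if_reachable_from:
  assumes "\<And>v. v \<in> mg_verts G \<Longrightarrow> (mg_adj G)\<^sup>*\<^sup>* w v"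
  shows "mg_connected G"
proof -
  have "symp (mg_adj G)\<^sup>*\<^sup>*"
    by (intro symp_rtranclp sympI) (simp add: mg_adj_def insert_commute)
  then show ?thesis
    unfolding mg_connected_def using assms by (auto dest: sympD intro: rtranclp_trans)
qed

section \<open>Two stars linked by a path\<close>

datatype vertex = Path nat | Leaf bool nat | Centre bool

instance vertex :: countable
  by countable_datatype

definition path_end :: "nat \<Rightarrow> bool \<Rightarrow> nat" where
  "path_end n s = (if s then n else 0)"

definition path_verts :: "nat \<Rightarrow> vertex set" where
  "path_verts n = Path ` {..n}"

definition star_verts :: "nat \<Rightarrow> bool \<Rightarrow> vertex set" where
  "star_verts r s = insert (Centre s) (Leaf s ` {..<r})"

definition linked_verts :: "nat \<Rightarrow> nat \<Rightarrow> vertex set" where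
  "linked_verts n r = path_verts n \<union> star_verts r False \<union> star_verts r True"

text \<open>The multiplicity 2 r + 1 exceeds the degree of every divisor that the lower bounds rule out.\<close>

definition star_edges :: "nat \<Rightarrow> nat \<Rightarrow> bool \<Rightarrow> (vertex \<times> vertex) multiset" where
  "star_edges n r s =
     image_mset (\<lambda>j. (Leaf s j, Centre s)) (mset_set {..<r}) +
     repeat_mset (2 * r + 1) (image_mset (\<lambda>j. (Path (path_end n s), Leaf s j)) (mset_set {..<r}))"

definition linked_edges :: "nat \<Rightarrow> nat \<Rightarrow> nat \<Rightarrow> (vertex \<times> vertex) multiset" where
  "linked_edges n r k =
     image_mset (\<lambda>i. (Path i, Path (Suc i))) (mset_set {..<n}) +
     star_edges n r False + star_edges n r True +
     replicate_mset k (Centre False, Centre True)"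

definition linked_stars :: "nat \<Rightarrow> nat \<Rightarrow> nat \<Rightarrow> vertex mgraph" where
  "linked_stars n r k = mgraph_of (linked_verts n r) (linked_edges n r k)"

lemma path_end_le [simp]: "path_end n s \<le> n"
  by (simp add: path_end_def)

lemma mg_verts_linked_stars [simp]: "mg_verts (linked_stars n r k) = linked_verts n r"
  by (simp add: linked_stars_def)

lemma finite_linked_verts [simp]: "finite (linked_verts n r)"
  by (simp add: linked_verts_def path_verts_def star_verts_def)

lemma mem_linked_verts [simp]:
  "Path i \<in> linked_verts n r \<longleftrightarrow> i \<le> n"
  "Leaf s j \<in> linked_verts n r \<longleftrightarrow> j < r"
  "Centre s \<in> linked_verts n r"
  by (cases s; auto simp: linked_verts_def path_verts_def star_verts_def)+

lemma path_verts_subset: "path_verts n \<subseteq> linked_verts n r"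
  by (auto simp: linked_verts_def)

lemma star_verts_subset: "star_verts r s \<subseteq> linked_verts n r"
  by (cases s) (auto simp: linked_verts_def)

lemma sum_path_verts: "(\<Sum>v\<in>path_verts n. g v) = (\<Sum>i\<le>n. g (Path i))"
  by (simp add: path_verts_def sum.reindex inj_on_def)

lemma sum_star_verts: "(\<Sum>v\<in>star_verts r s. g v) = g (Centre s) + (\<Sum>j<r. g (Leaf s j))"
  by (simp add: star_verts_def sum.reindex inj_on_def image_iff)

lemma div_degree_linked_stars:
  "div_degree (linked_stars n r k) D =
    (\<Sum>v\<in>path_verts n. D v) + (\<Sum>v\<in>star_verts r False. D v) + (\<Sum>v\<in>star_verts r True. D v)"
proof -
  have "finite (path_verts n)" "finite (star_verts r s)" "path_verts n \<inter> star_verts r s = {}" for s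
    by (auto simp: path_verts_def star_verts_def)
  moreover have "star_verts r False \<inter> star_verts r True = {}"
    by (auto simp: star_verts_def)
  ultimately show ?thesis
    by (simp add: div_degree_def linked_verts_def sum.union_disjoint Int_Un_distrib2)
qed

lemma mem_repeat_mset: "x \<in># repeat_mset n M \<longleftrightarrow> 0 < n \<and> x \<in># M"
  by (simp flip: count_greater_zero_iff)

lemma mem_star_edges:
  "(a, b) \<in># star_edges n r s \<longleftrightarrow>
    (\<exists>j<r. a = Leaf s j \<and> b = Centre s \<or> a = Path (path_end n s) \<and> b = Leaf s j)"
  by (auto simp: star_edges_def mem_repeat_mset simp del: repeat_mset_Suc)

lemma mem_linked_edges:
  "(a, b) \<in># linked_edges n r k \<longleftrightarrow>
    (\<exists>i<n. a = Path i \<and> b = Path (Suc i)) \<or> (\<exists>s. (a, b) \<in># star_edges n r s) \<or>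
    (0 < k \<and> a = Centre False \<and> b = Centre True)"
  by (auto simp: linked_edges_def ex_bool_eq)

lemma linked_edges_in_verts:
  "(a, b) \<in># linked_edges n r k \<Longrightarrow> a \<in> linked_verts n r \<and> b \<in> linked_verts n r \<and> a \<noteq> b"
  by (auto simp: mem_linked_edges mem_star_edges)

lemma multigraph_linked_stars: "multigraph (linked_stars n r k)"
  unfolding linked_stars_def
proof (rule multigraph_mgraph_of)
  show "linked_verts n r \<noteq> {}" using mem_linked_verts(3) by blast
qed (simp_all add: linked_edges_in_verts)

lemma mg_connected_linked_stars:
  assumes "1 \<le> r"
  shows "mg_connected (linked_stars n r k)"
proof (rule mg_connected_if_reachable_from)
  let ?R = "(mg_adj (linked_stars n r k))\<^sup>*\<^sup>*"
  have extend: "?R (Path 0) b" if "?R (Path 0) a" "(a, b) \<in># linked_edges n r k" for a b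
    using that mg_adj_mgraph_of[OF that(2)] unfolding linked_stars_def
    by (blast intro: rtranclp.rtrancl_into_rtrancl)
  have path: "?R (Path 0) (Path i)" if "i \<le> n" for i
    using that by (induction i) (auto intro: extend simp: mem_linked_edges)
  have leaf: "?R (Path 0) (Leaf s j)" if "j < r" for s j
    by (rule extend[of "Path (path_end n s)"])
      (use that in \<open>auto intro: path simp: mem_linked_edges mem_star_edges\<close>)
  have centre: "?R (Path 0) (Centre s)" for s
    by (rule extend[OF leaf[of 0 s]]) (use assms in \<open>auto simp: mem_linked_edges mem_star_edges\<close>)
  fix v assume "v \<in> mg_verts (linked_stars n r k)"
  then show "?R (Path 0) v" by (cases v) (auto intro: path leaf centre)
qed

lemma centre_edge_mem_linked_stars:
  "{Centre False, Centre True} \<in># mg_edges (linked_stars n r (Suc k))"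
  by (simp add: linked_stars_def mgraph_of_def linked_edges_def)

lemma mg_delete_edge_linked_stars:
  "mg_delete_edge (linked_stars n r (Suc k)) {Centre False, Centre True} = linked_stars n r k"
  by (simp add: mg_delete_edge_def linked_stars_def mgraph_of_def linked_edges_def)

lemma count_heavy_edge_ge:
  assumes "j < r"
  shows "2 * r + 1 \<le> count (mg_edges (linked_stars n r k)) {Path (path_end n s), Leaf s j}"
proof -
  let ?e = "(Path (path_end n s), Leaf s j)"
  have "count (image_mset (\<lambda>j. (Path (path_end n s), Leaf s j)) (mset_set {..<r})) ?e = 1"
    using assms count_image_mset_inj[of "\<lambda>j. (Path (path_end n s), Leaf s j)" "mset_set {..<r}" j]
    by (simp add: inj_def)
  then have "2 * r + 1 \<le> count (star_edges n r s) ?e"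
    unfolding star_edges_def count_union count_repeat_mset by simp
  also have "\<dots> \<le> count (linked_edges n r k) ?e"
    unfolding linked_edges_def by (cases s) simp_all
  also have "\<dots> \<le> count (mg_edges (linked_stars n r k)) {Path (path_end n s), Leaf s j}"
    unfolding linked_stars_def by (rule count_mgraph_of_ge)
  finally show ?thesis .
qed

definition constant_on_clusters :: "nat \<Rightarrow> nat \<Rightarrow> (vertex \<Rightarrow> int) \<Rightarrow> bool" where
  "constant_on_clusters n r f \<longleftrightarrow> (\<forall>s. \<forall>j<r. f (Leaf s j) = f (Path (path_end n s)))"

lemma sum_mset_repeat_mset:
  "(\<Sum>x\<in>#repeat_mset n M. g x) = of_nat n * (\<Sum>x\<in>#M. g x :: 'a :: comm_semiring_1)"
  by (induction n) (simp_all add: algebra_simps)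

lemma sum_mg_laplacian_linked_stars:
  assumes f: "constant_on_clusters n r f" and A: "A \<subseteq> linked_verts n r"
  shows "(\<Sum>v\<in>A. mg_laplacian (linked_stars n r k) f v) =
    (\<Sum>i<n. (of_bool (Path i \<in> A) - of_bool (Path (Suc i) \<in> A)) * (f (Path i) - f (Path (Suc i)))) +
    (\<Sum>s\<in>UNIV. (\<Sum>j<r. of_bool (Leaf s j \<in> A) - of_bool (Centre s \<in> A)) *
        (f (Path (path_end n s)) - f (Centre s))) +
    int k * (of_bool (Centre False \<in> A) - of_bool (Centre True \<in> A)) *
        (f (Centre False) - f (Centre True))"
proof -
  let ?flow = "\<lambda>(a, b). (of_bool (a \<in> A) - of_bool (b \<in> A)) * (f a - f b)"
  have "f (Leaf s j) = f (Path (path_end n s))" if "j < r" for s j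
    using f that by (simp add: constant_on_clusters_def)
  then have "(\<Sum>x\<in>#star_edges n r s. ?flow x) =
      (\<Sum>j<r. of_bool (Leaf s j \<in> A) - of_bool (Centre s \<in> A)) *
        (f (Path (path_end n s)) - f (Centre s))" for s
    unfolding star_edges_def
    by (simp add: sum_mset_repeat_mset image_mset.compositionality comp_def
        sum_unfold_sum_mset[symmetric] sum_distrib_right del: repeat_mset_Suc)
  moreover have "(\<Sum>v\<in>A. mg_laplacian (linked_stars n r k) f v) =
      (\<Sum>x\<in>#linked_edges n r k. ?flow x)"
    unfolding linked_stars_def
    by (rule sum_mg_laplacian_mgraph_of[OF finite_linked_verts A linked_edges_in_verts])
  ultimately show ?thesis
    by (simp add: linked_edges_def image_mset.compositionality comp_def
        sum_unfold_sum_mset[symmetric] UNIV_bool)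
qed

lemma sum_fire_path_verts:
  assumes "constant_on_clusters n r f"
  shows "(\<Sum>v\<in>path_verts n. fire (linked_stars n r k) f D v) = (\<Sum>v\<in>path_verts n. D v)"
proof -
  have "(\<Sum>v\<in>path_verts n. mg_laplacian (linked_stars n r k) f v) = 0"
    unfolding sum_mg_laplacian_linked_stars[OF assms path_verts_subset]
    by (simp add: path_verts_def image_iff)
  then show ?thesis by (simp add: fire_def sum_subtractf)
qed

lemma sum_fire_star_verts:
  assumes "constant_on_clusters n r f"
  shows "(\<Sum>v\<in>star_verts r s. fire (linked_stars n r k) f D v) =
    (\<Sum>v\<in>star_verts r s. D v) - int k * (f (Centre s) - f (Centre (\<not> s)))"
proof -
  have "(\<Sum>v\<in>star_verts r s. mg_laplacian (linked_stars n r k) f v) =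
      int k * (f (Centre s) - f (Centre (\<not> s)))"
    unfolding sum_mg_laplacian_linked_stars[OF assms star_verts_subset]
    by (cases s) (simp_all add: star_verts_def image_iff UNIV_bool algebra_simps)
  then show ?thesis by (simp add: fire_def sum_subtractf)
qed

lemma mg_laplacian_path:
  assumes f: "constant_on_clusters n r f" and i: "i \<le> n"
  shows "mg_laplacian (linked_stars n r k) f (Path i) =
    (if i < n then f (Path i) - f (Path (Suc i)) else 0) +
    (if 0 < i then f (Path i) - f (Path (i - 1)) else 0)"
proof -
  let ?d = "\<lambda>i. f (Path i) - f (Path (Suc i))"
  have "mg_laplacian (linked_stars n r k) f (Path i) =
      (\<Sum>i'<n. (of_bool (i' = i) - of_bool (Suc i' = i)) * ?d i')"
    using sum_mg_laplacian_linked_stars[OF f, of "{Path i}" k] i by simp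
  also have "\<dots> = (\<Sum>i'<n. if i' = i then ?d i' else 0) - (\<Sum>i'<n. if Suc i' = i then ?d i' else 0)"
    unfolding sum_subtractf[symmetric] by (intro sum.cong refl) auto
  also have "(\<Sum>i'<n. if i' = i then ?d i' else 0) = (if i < n then ?d i else 0)"
    by simp
  also have "(\<Sum>i'<n. if Suc i' = i then ?d i' else 0) = (if 0 < i then ?d (i - 1) else 0)"
    using i by (cases i) simp_all
  finally show ?thesis by auto
qed

lemma mg_laplacian_leaf:
  assumes f: "constant_on_clusters n r f" and "j < r"
  shows "mg_laplacian (linked_stars n r k) f (Leaf s j) = f (Path (path_end n s)) - f (Centre s)"
proof -
  have "(\<Sum>j'<r. of_bool (j' = j)) = (1 :: int)"
    using assms by (simp add: of_bool_def)
  then show ?thesis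
    using sum_mg_laplacian_linked_stars[OF f, of "{Leaf s j}" k] assms
    by (cases s) (simp_all add: UNIV_bool)
qed

lemma mg_laplacian_centre:
  assumes f: "constant_on_clusters n r f"
  shows "mg_laplacian (linked_stars n r k) f (Centre s) =
    int r * (f (Centre s) - f (Path (path_end n s))) +
    int k * (f (Centre s) - f (Centre (\<not> s)))"
  using sum_mg_laplacian_linked_stars[OF f, of "{Centre s}" k]
  by (cases s) (simp_all add: UNIV_bool algebra_simps)

section \<open>Lower bounds\<close>

lemma constant_on_clusters_if_small_degree:
  assumes D: "div_effective (linked_stars n r k) D" "div_degree (linked_stars n r k) D \<le> 2 * int r"
    and f: "div_effective (linked_stars n r k) (fire (linked_stars n r k) f D)"
  shows "constant_on_clusters n r f"
  unfolding constant_on_clusters_def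
proof (intro allI impI)
  fix s j assume j: "j < r"
  have "div_degree (linked_stars n r k) D <
      int (count (mg_edges (linked_stars n r k)) {Path (path_end n s), Leaf s j})"
    using D(2) count_heavy_edge_ge[OF j, of n k s] by simp
  then have "f (Path (path_end n s)) = f (Leaf s j)"
    using j by (intro script_eq_across_heavy_edge[OF multigraph_linked_stars _ _ D(1) f]) simp_all
  then show "f (Leaf s j) = f (Path (path_end n s))" ..
qed

lemma path_degree_ge_one:
  assumes D: "div_effective (linked_stars n r k) D" "div_degree (linked_stars n r k) D \<le> 2 * int r"
    and rank: "0 < div_rank (linked_stars n r k) D"
  shows "1 \<le> (\<Sum>v\<in>path_verts n. D v)"
proof -
  let ?G = "linked_stars n r k"
  obtain f where f: "div_effective ?G (fire ?G f D)" "1 \<le> fire ?G f D (Path 0)"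
    using rank div_rank_pos_iff[OF multigraph_linked_stars] by fastforce
  note f(2)
  also have "fire ?G f D (Path 0) \<le> (\<Sum>v\<in>path_verts n. fire ?G f D v)"
    using f(1) by (intro member_le_sum) (auto simp: div_effective_def path_verts_def)
  also have "\<dots> = (\<Sum>v\<in>path_verts n. D v)"
    by (rule sum_fire_path_verts[OF constant_on_clusters_if_small_degree[OF D f(1)]])
  finally show ?thesis .
qed

text \<open>
  All leaves of a star gain the same number of chips, so a chip on an initially empty leaf
  means a chip on every leaf.
\<close>

lemma all_leaves_occupied:
  assumes D: "div_effective (linked_stars n r k) D" "div_degree (linked_stars n r k) D \<le> 2 * int r"
    and rank: "0 < div_rank (linked_stars n r k) D"
  obtains f where "div_effective (linked_stars n r k) (fire (linked_stars n r k) f D)"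
    "\<And>j. j < r \<Longrightarrow> 1 \<le> fire (linked_stars n r k) f D (Leaf s j)"
proof (cases "\<exists>j<r. D (Leaf s j) \<le> 0")
  case False
  with D(1) show ?thesis by (intro that[of "\<lambda>_. 0"]) auto
next
  case True
  let ?G = "linked_stars n r k"
  obtain j where j: "j < r" "D (Leaf s j) \<le> 0" using True by blast
  then obtain f where f: "div_effective ?G (fire ?G f D)" "1 \<le> fire ?G f D (Leaf s j)"
    using rank div_rank_pos_iff[OF multigraph_linked_stars] by fastforce
  have "1 \<le> fire ?G f D (Leaf s i)" if i: "i < r" for i
  proof -
    have "0 \<le> D (Leaf s i)" using D(1) i by (simp add: div_effective_def)
    then show ?thesis
      using f(2) j i
      by (simp add: fire_def mg_laplacian_leaf[OF constant_on_clusters_if_small_degree[OF D f(1)]])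
  qed
  with f(1) show ?thesis by (rule that)
qed

lemma star_degree_ge_after_firing:
  assumes D: "div_effective (linked_stars n r k) D" "div_degree (linked_stars n r k) D \<le> 2 * int r"
    and rank: "0 < div_rank (linked_stars n r k) D"
  obtains f where "constant_on_clusters n r f"
    "div_effective (linked_stars n r k) (fire (linked_stars n r k) f D)"
    "int r \<le> (\<Sum>v\<in>star_verts r s. fire (linked_stars n r k) f D v)"
proof -
  let ?G = "linked_stars n r k"
  obtain f where f: "div_effective ?G (fire ?G f D)" "\<And>j. j < r \<Longrightarrow> 1 \<le> fire ?G f D (Leaf s j)"
    using all_leaves_occupied[OF D rank, of s] by blast
  have "(\<Sum>j<r. 1) \<le> (\<Sum>j<r. fire ?G f D (Leaf s j))"
    by (rule sum_mono) (simp add: f(2))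
  moreover have "0 \<le> fire ?G f D (Centre s)"
    using f(1) by (simp add: div_effective_def)
  ultimately have "int r \<le> (\<Sum>v\<in>star_verts r s. fire ?G f D v)"
    by (simp add: sum_star_verts)
  then show ?thesis
    using that constant_on_clusters_if_small_degree[OF D f(1)] f(1) by blast
qed

lemma div_degree_linked_stars_ge:
  assumes D: "div_effective (linked_stars n r k) D" and rank: "0 < div_rank (linked_stars n r k) D"
  shows "int (r + 1) \<le> div_degree (linked_stars n r k) D"
proof (cases "div_degree (linked_stars n r k) D \<le> 2 * int r")
  case True
  let ?D' = "\<lambda>f. fire (linked_stars n r k) f D"
  obtain f where f: "constant_on_clusters n r f" "div_effective (linked_stars n r k) (?D' f)"
      "int r \<le> (\<Sum>v\<in>star_verts r False. ?D' f v)"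
    using star_degree_ge_after_firing[OF D True rank] .
  have "0 \<le> (\<Sum>v\<in>star_verts r True. ?D' f v)"
    using f(2) star_verts_subset[of r True n] by (intro sum_nonneg) (auto simp: div_effective_def)
  moreover have "1 \<le> (\<Sum>v\<in>path_verts n. ?D' f v)"
    using path_degree_ge_one[OF D True rank] by (simp add: sum_fire_path_verts[OF f(1)])
  ultimately have "int (r + 1) \<le> div_degree (linked_stars n r k) (?D' f)"
    using f(3) unfolding div_degree_linked_stars by linarith
  then show ?thesis by simp
qed simp

lemma div_degree_linked_stars_no_edge_ge:
  assumes D: "div_effective (linked_stars n r 0) D" and rank: "0 < div_rank (linked_stars n r 0) D"
  shows "int (2 * r + 1) \<le> div_degree (linked_stars n r 0) D"
proof (rule ccontr)
  assume "\<not> ?thesis"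
  then have small: "div_degree (linked_stars n r 0) D \<le> 2 * int r" by simp
  have "int r \<le> (\<Sum>v\<in>star_verts r s. D v)" for s
    by (rule star_degree_ge_after_firing[OF D small rank, of s]) (simp add: sum_fire_star_verts)
  from this[of False] this[of True] show False
    using path_degree_ge_one[OF D small rank] small unfolding div_degree_linked_stars by linarith
qed

section \<open>Divisors attaining the bounds\<close>

text \<open>
  Put the i-th vertex of the path on level i, the leaves on the level of the end of the path they
  are tied to, and the centre of star s on level c s. The script with parameter t fires, for each
  i < t, all vertices of level at most i; its values are truncated differences.
\<close>

fun sweep :: "nat \<Rightarrow> (bool \<Rightarrow> nat) \<Rightarrow> nat \<Rightarrow> vertex \<Rightarrow> int" where
  "sweep n c t (Path i) = int (t - i)"
| "sweep n c t (Leaf s j) = int (t - path_end n s)"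
| "sweep n c t (Centre s) = int (t - c s)"

lemma constant_on_clusters_sweep: "constant_on_clusters n r (sweep n c t)"
  by (simp add: constant_on_clusters_def)

lemma mg_laplacian_sweep_path:
  assumes "i \<le> n" "t \<le> n"
  shows "mg_laplacian (linked_stars n r k) (sweep n c t) (Path i) =
    of_bool (i = 0) - of_bool (i = t)"
  using assms by (auto simp: mg_laplacian_path[OF constant_on_clusters_sweep])

lemma sum_path_verts_of_bool: "(\<Sum>i\<le>n :: nat. of_bool (i = 0)) = (1 :: int)"
  by (simp add: of_bool_def)

text \<open>
  The t-th level of a map of degree r + 1 from the linked stars to a path with r + 2 edges, which
  has expansion factor r along the edge between the two centres.
\<close>

fun level_divisor :: "nat \<Rightarrow> nat \<Rightarrow> vertex divisor" where
  "level_divisor r t (Path i) = of_bool (i = t)"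
| "level_divisor r t (Leaf s j) = of_bool (t = path_end (r + 2) s)"
| "level_divisor r t (Centre s) =
     (if t = 0 \<or> t = r + 2 then 0 else if s then int t - 1 else int r + 1 - int t)"

definition centre_level :: "nat \<Rightarrow> bool \<Rightarrow> nat" where
  "centre_level r s = (if s then r + 1 else 1)"

lemma fire_sweep_level_divisor:
  assumes v: "v \<in> linked_verts (r + 2) r" and t: "t \<le> r + 2"
  shows "fire (linked_stars (r + 2) r 1) (sweep (r + 2) (centre_level r) t) (level_divisor r 0) v =
    level_divisor r t v"
proof (cases v)
  case (Path i)
  with v t show ?thesis by (simp add: fire_def mg_laplacian_sweep_path)
next
  case (Leaf s j)
  with v t show ?thesis
    by (auto simp: fire_def mg_laplacian_leaf[OF constant_on_clusters_sweep] centre_level_def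
        path_end_def)
next
  case (Centre s)
  consider "t = 0" | "1 \<le> t" "t \<le> r + 1" | "t = r + 2" using t by linarith
  then show ?thesis
    unfolding Centre fire_def mg_laplacian_centre[OF constant_on_clusters_sweep]
    by cases (auto simp: centre_level_def path_end_def of_nat_diff algebra_simps)
qed

lemma level_divisor_nonneg: "t \<le> r + 2 \<Longrightarrow> 0 \<le> level_divisor r t v"
  by (cases v) auto

lemma ex_level_divisor_ge_one:
  assumes "1 \<le> r" "v \<in> linked_verts (r + 2) r"
  shows "\<exists>t\<le>r + 2. 1 \<le> level_divisor r t v"
proof (cases v)
  case (Path i)
  with assms show ?thesis by (intro exI[of _ i]) simp
next
  case (Leaf s j)
  then show ?thesis by (intro exI[of _ "path_end (r + 2) s"]) simp
next
  case (Centre s)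
  with assms show ?thesis by (intro exI[of _ "centre_level r s"]) (simp add: centre_level_def)
qed

lemma gonality_linked_stars_one_edge:
  assumes "1 \<le> r"
  shows "gonality (linked_stars (r + 2) r 1) = r + 1"
proof (rule gonality_eqI[OF multigraph_linked_stars _ _ div_degree_linked_stars_ge])
  let ?G = "linked_stars (r + 2) r 1" and ?f = "sweep (r + 2) (centre_level r)"
  show "div_degree ?G (level_divisor r 0) = int (r + 1)"
    unfolding div_degree_linked_stars sum_path_verts sum_star_verts
    by (simp add: sum_path_verts_of_bool path_end_def del: sum.atMost_Suc add_2_eq_Suc')
  have "\<exists>f. div_effective ?G (fire ?G f (level_divisor r 0)) \<and> 1 \<le> fire ?G f (level_divisor r 0) v"
    if v: "v \<in> linked_verts (r + 2) r" for v
  proof -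
    obtain t where "t \<le> r + 2" "1 \<le> level_divisor r t v"
      using ex_level_divisor_ge_one[OF assms v] by blast
    then show ?thesis
      using v by (intro exI[of _ "?f t"])
        (simp add: div_effective_def fire_sweep_level_divisor level_divisor_nonneg
          del: add_2_eq_Suc' One_nat_def)
  qed
  then show "0 < div_rank ?G (level_divisor r 0)"
    by (simp add: div_rank_pos_iff[OF multigraph_linked_stars])
qed

fun leaves_divisor :: "nat \<Rightarrow> vertex divisor" where
  "leaves_divisor t (Path i) = of_bool (i = t)"
| "leaves_divisor t (Leaf s j) = 1"
| "leaves_divisor t (Centre s) = 0"

lemma fire_sweep_leaves_divisor:
  assumes "v \<in> linked_verts n r" "t \<le> n"
  shows "fire (linked_stars n r 0) (sweep n (path_end n) t) (leaves_divisor 0) v =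
    leaves_divisor t v"
  using assms
  by (cases v) (simp_all add: fire_def mg_laplacian_sweep_path
      mg_laplacian_leaf[OF constant_on_clusters_sweep]
      mg_laplacian_centre[OF constant_on_clusters_sweep])

lemma fire_borrow_at_centre:
  assumes v: "v \<in> linked_verts n r"
  shows "fire (linked_stars n r 0) (chips_at (Centre s) (- 1)) (leaves_divisor t) v =
    (case v of Path i \<Rightarrow> of_bool (i = t) | Leaf s' j \<Rightarrow> of_bool (s' \<noteq> s)
      | Centre s' \<Rightarrow> if s' = s then int r else 0)"
proof -
  have f: "constant_on_clusters n r (chips_at (Centre s) (- 1))"
    by (simp add: constant_on_clusters_def chips_at_def)
  show ?thesis
    using v by (cases v) (auto simp: fire_def mg_laplacian_path[OF f] mg_laplacian_leaf[OF f]
        mg_laplacian_centre[OF f] chips_at_def)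
qed

lemma div_rank_leaves_divisor_pos:
  assumes "1 \<le> r"
  shows "0 < div_rank (linked_stars n r 0) (leaves_divisor 0)"
  unfolding div_rank_pos_iff[OF multigraph_linked_stars] mg_verts_linked_stars
proof
  let ?G = "linked_stars n r 0" and ?D = "leaves_divisor 0"
  have nonneg: "0 \<le> leaves_divisor t w" for t w by (cases w) simp_all
  fix v assume v: "v \<in> linked_verts n r"
  consider (swept) t where "t \<le> n" "1 \<le> leaves_divisor t v" | (centre) s where "v = Centre s"
    using v by (cases v) auto
  then show "\<exists>f. div_effective ?G (fire ?G f ?D) \<and> 1 \<le> fire ?G f ?D v"
  proof cases
    case (swept t)
    then show ?thesis
      using v nonneg by (intro exI[of _ "sweep n (path_end n) t"])
        (simp add: div_effective_def fire_sweep_leaves_divisor)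
  next
    case (centre s)
    then show ?thesis
      using assms by (intro exI[of _ "chips_at (Centre s) (- 1)"])
        (simp add: div_effective_def fire_borrow_at_centre split: vertex.split)
  qed
qed

lemma gonality_linked_stars_no_edge:
  assumes "1 \<le> r"
  shows "gonality (linked_stars n r 0) = 2 * r + 1"
proof (rule gonality_eqI[OF multigraph_linked_stars _ div_rank_leaves_divisor_pos[OF assms]
      div_degree_linked_stars_no_edge_ge])
  show "div_degree (linked_stars n r 0) (leaves_divisor 0) = int (2 * r + 1)"
    unfolding div_degree_linked_stars sum_path_verts sum_star_verts
    by (simp add: sum_path_verts_of_bool)
qed

theorem theorem1p2:
  fixes r :: nat
  assumes "r \<ge> 1"
  shows "\<exists>(G :: nat mgraph) e.
           multigraph G \<and> mg_connected G \<and>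
           e \<in># mg_edges G \<and> mg_connected (mg_delete_edge G e) \<and>
           gonality (mg_delete_edge G e) = gonality G + r"
proof (intro exI conjI)
  let ?H = "linked_stars (r + 2) r" and ?e = "{Centre False, Centre True}"
  let ?G = "map_mgraph to_nat (?H 1)"
  have e: "?e \<in># mg_edges (?H 1)"
    using centre_edge_mem_linked_stars[of "r + 2" r 0] by simp
  have delete: "mg_delete_edge ?G (to_nat ` ?e) = map_mgraph to_nat (?H 0)"
    unfolding mg_delete_edge_map_mgraph[OF e]
    using mg_delete_edge_linked_stars[of "r + 2" r 0] by simp
  show "multigraph ?G"
    by (intro multigraph_map_mgraph inj_to_nat multigraph_linked_stars)
  show "mg_connected ?G"
    by (intro mg_connected_map_mgraph mg_connected_linked_stars assms)
  show "to_nat ` ?e \<in># mg_edges ?G"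
    unfolding mg_edges_map_mgraph set_image_mset using e by (rule imageI)
  show "mg_connected (mg_delete_edge ?G (to_nat ` ?e))"
    unfolding delete by (intro mg_connected_map_mgraph mg_connected_linked_stars assms)
  show "gonality (mg_delete_edge ?G (to_nat ` ?e)) = gonality ?G + r"
    unfolding delete gonality_map_mgraph[OF inj_to_nat]
      gonality_linked_stars_one_edge[OF assms] gonality_linked_stars_no_edge[OF assms] by simp
qed

end
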